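(* Consider a 2D state-space system with $C$ variables. (1) If inter-variable coupling is implemented via ordered recurrence (e.g., $h_v(t,c+1)$ depends on $h_v(t,c)$), then the update at each fixed time $t$ induces a dependency chain of length $C$ along the variable axis. (2) In contrast, any formulation that mediates inter-variable interaction through a permutation-invariant aggregated descriptor $\psi(t)$ admits $\mathcal{O}(1)$ variable-axis dependency depth, since no sequential dependency is introduced once $\psi(t)$ is computed.
   Context: A 2D state-space system here carries, for each variable $c\in\{1,\dots,C\}$ and time $t$, latent states, among them a vertical state $h_v(t,c)$ that carries information along the variable axis. A permutation-invariant aggregated descriptor $\psi(t)$ is a quantity obtained by aggregating per-variable quantities at time $t$ with a function whose value does not change when the $C$ variables are permuted (e.g. a mean, a sum, or attention-based pooling). The variable-axis dependency depth is measured as the length of the longest directed path in the computational graph at a fixed time step $t$. *)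

theory Defs
  imports "Graph_Theory.Graph_Theory"
begin

text \<open>
  The quantities computed at one time step. \<open>Local k c\<close> is the quantity of kind \<open>k\<close> attached to
  variable \<open>c\<close>; the kinds comprise the latent states and whatever else a system computes per
  variable (embedded inputs, gates, outputs). \<open>Descriptor\<close> is the aggregated descriptor; a system
  that does not use one leaves it an isolated vertex of the computational graph.
\<close>

datatype 'k quantity = Local 'k nat | Descriptor

text \<open>
  With \<open>h t q\<close> the value of quantity \<open>q\<close> at time \<open>t\<close> and \<open>x t c\<close> the external input, a system \<open>S\<close>
  stands for the equations \<open>h t q = update S t q (x t) (h (t - 1)) (h t)\<close>. The operands of \<open>q\<close> are
  the quantities of the same time step that the formula for \<open>q\<close> reads. Values of all quantities
  share one type, which may be a sum or list type if dimensions differ.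
\<close>

record ('k, 'x, 'a) system_2d =
  nvars :: nat
  vertical :: 'k
  operands :: "nat \<Rightarrow> 'k quantity \<Rightarrow> 'k quantity set"
  update :: "nat \<Rightarrow> 'k quantity \<Rightarrow> (nat \<Rightarrow> 'x) \<Rightarrow> ('k quantity \<Rightarrow> 'a) \<Rightarrow> ('k quantity \<Rightarrow> 'a) \<Rightarrow> 'a"

abbreviation vertical_state :: "('k, 'x, 'a) system_2d \<Rightarrow> nat \<Rightarrow> 'k quantity" where
  "vertical_state S c \<equiv> Local (vertical S) c"

definition quantities :: "('k, 'x, 'a) system_2d \<Rightarrow> 'k quantity set" where
  "quantities S = insert Descriptor {Local k c | k c. c \<in> {1..nvars S}}"

definition comp_graph :: "('k, 'x, 'a) system_2d \<Rightarrow> nat \<Rightarrow> 'k quantity pair_pre_digraph" where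
  "comp_graph S t =
    \<lparr>pverts = quantities S, parcs = {(p, q). q \<in> quantities S \<and> p \<in> operands S t q}\<rparr>"

text \<open>
  Acyclicity makes the equations of one time step explicitly evaluable. The last condition says that
  the declared operands are all that an update reads from the current time step.
\<close>

definition is_system_2d :: "('k, 'x, 'a) system_2d \<Rightarrow> bool" where
  "is_system_2d S \<longleftrightarrow>
    nvars S \<ge> 1 \<and>
    (\<forall>t. \<forall>q\<in>quantities S. operands S t q \<subseteq> quantities S) \<and>
    (\<forall>t. acyclic (parcs (comp_graph S t))) \<and>
    (\<forall>t. \<forall>q\<in>quantities S. \<forall>x prev cur cur'.
      (\<forall>p\<in>operands S t q. cur p = cur' p) \<longrightarrow>
      update S t q x prev cur = update S t q x prev cur')"

text \<open>
  The length of a path is the number of its vertices, that is, of quantities that have to be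
  evaluated one after another (\<open>vwalk_length\<close> would be one less). With this convention the
  chain through the vertical states of \<open>C\<close> variables has length \<open>C\<close>. Since the graph is finite and
  acyclic, the maximum exists and restricting to paths without repeated vertices is no loss.
\<close>

definition dependency_depth :: "('k, 'x, 'a) system_2d \<Rightarrow> nat \<Rightarrow> nat" where
  "dependency_depth S t = Max {length p | p. vpath p (with_proj (comp_graph S t))}"

text \<open>Genuine functional dependence: changing the value of \<open>p\<close> alone can change that of \<open>q\<close>.\<close>

definition depends_on ::
    "('k, 'x, 'a) system_2d \<Rightarrow> nat \<Rightarrow> 'k quantity \<Rightarrow> 'k quantity \<Rightarrow> bool" where
  "depends_on S t q p \<longleftrightarrow>
    (\<exists>x prev cur a. update S t q x prev (cur(p := a)) \<noteq> update S t q x prev cur)"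

text \<open>\<open>\<sigma>\<close> is the order in which the variables are scanned; the natural order is \<open>\<sigma> = id\<close>.\<close>

definition ordered_recurrence :: "('k, 'x, 'a) system_2d \<Rightarrow> (nat \<Rightarrow> nat) \<Rightarrow> bool" where
  "ordered_recurrence S \<sigma> \<longleftrightarrow>
    \<sigma> permutes {1..nvars S} \<and>
    (\<forall>t. \<forall>c\<in>{1..<nvars S}.
      depends_on S t (vertical_state S (\<sigma> (c + 1))) (vertical_state S (\<sigma> c)))"

definition permutation_invariant :: "nat \<Rightarrow> ((nat \<Rightarrow> 'b) \<Rightarrow> 'a) \<Rightarrow> bool" where
  "permutation_invariant C agg \<longleftrightarrow> (\<forall>\<pi> v. \<pi> permutes {1..C} \<longrightarrow> agg (v \<circ> \<pi>) = agg v)"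

text \<open>
  The aggregation sees, for each variable, the tuple of that variable's quantities at time \<open>t\<close>, and
  it is a single vertex of the computational graph. Everything else that is computed for a
  variable may use only the input, the past and the present of that same variable, and the descriptor.
\<close>

definition descriptor_mediated :: "('k, 'x, 'a) system_2d \<Rightarrow> bool" where
  "descriptor_mediated S \<longleftrightarrow>
    (\<forall>t. \<exists>agg. permutation_invariant (nvars S) agg \<and>
      (\<forall>x prev cur. update S t Descriptor x prev cur = agg (\<lambda>c k. cur (Local k c)))) \<and>
    (\<forall>t k. \<forall>c\<in>{1..nvars S}.
      operands S t (Local k c) \<subseteq> insert Descriptor (range (\<lambda>j. Local j c)) \<and>
      (\<forall>x x' prev prev' cur.
        x c = x' c \<and> prev Descriptor = prev' Descriptor \<and>
        (\<forall>j. prev (Local j c) = prev' (Local j c)) \<longrightarrow>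
        update S t (Local k c) x prev cur = update S t (Local k c) x' prev' cur))"

end

theory Submission
  imports Defs "HOL-Library.Cardinality"
begin

text \<open>For ordered recurrence, an update ignores everything at the current time step except its
  declared operands, so genuine dependence forces an arc (\<open>depends_on_imp_operand\<close>).
  The vertical states, listed in the order \<open>\<sigma>\<close>, thus form a walk, which is a
  path because \<open>\<sigma>\<close> is injective (\<open>ordered_recurrence_vpath\<close>). For
  descriptor mediation, deleting \<open>Descriptor\<close> leaves only arcs between quantities of
  one variable, so a walk avoiding it stays in one column
  (\<open>descriptor_mediated_walk_column\<close>), which has \<open>CARD('k)\<close> vertices. A
  path meets \<open>Descriptor\<close> at most once and so splits into at most two such segments
  around it. The resulting bound \<open>2 * CARD('k) + 1\<close> does not involve the number of
  variables.\<close>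

text \<open>Vertices of a path are distinct, so no path is longer than the number of vertices.
  Finiteness is what makes the \<open>Max\<close> in \<open>dependency_depth\<close>
  meaningful.\<close>

lemma vpath_finite_lengths:
  assumes "finite (verts G)"
  shows "finite {length p | p. vpath p G}"
proof (rule finite_subset)
  have "length p \<le> card (verts G)" if "vpath p G" for p
    using that card_mono[OF assms, of "set p"] by (auto simp: vpath_def vwalk_def distinct_card)
  then show "{length p | p. vpath p G} \<subseteq> {..card (verts G)}"
    by blast
qed simp

lemma vwalk_map_upt:
  assumes "m < n"
    and "\<And>i. m \<le> i \<Longrightarrow> i < n \<Longrightarrow> f i \<in> verts G"
    and "\<And>i. m \<le> i \<Longrightarrow> Suc i < n \<Longrightarrow> (f i, f (Suc i)) \<in> arcs_ends G"
  shows "vwalk (map f [m..<n]) G"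
  using assms
\<comment> \<open>The base case contradicts \<open>m < n\<close>; the one-vertex walk is treated
  separately in the successor case, since walks are nonempty.\<close>
proof (induction "n - m" arbitrary: m)
  case (Suc d)
  show ?case
  proof (cases "Suc m = n")
    case True
    with Suc.prems(2)[of m] show ?thesis
      by (auto simp: vwalk_def)
  next
    case False
    then have "vwalk (map f [Suc m..<n]) G"
      using Suc by simp
    then have "vwalk (f m # map f [Suc m..<n]) G"
      using Suc.prems False by (intro vwalk_consI) (simp_all add: hd_map)
    with Suc.prems(1) show ?thesis
      by (simp add: upt_conv_Cons)
  qed
qed simp

lemma pverts_comp_graph [simp]: "pverts (comp_graph S t) = quantities S"
  by (simp add: comp_graph_def)

lemma parcs_comp_graph:
  "parcs (comp_graph S t) = {(p, q). q \<in> quantities S \<and> p \<in> operands S t q}"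
  by (simp add: comp_graph_def)

lemma finite_quantities: "finite (quantities (S :: ('k::finite, 'x, 'a) system_2d))"
proof -
  have "{Local k c | k c. c \<in> {1..nvars S}} = case_prod Local ` ((UNIV :: 'k set) \<times> {1..nvars S})"
    by force
  then show ?thesis
    by (simp add: quantities_def)
qed

lemma Local_in_quantities [simp]: "Local k c \<in> quantities S \<longleftrightarrow> c \<in> {1..nvars S}"
  by (auto simp: quantities_def)

text \<open>Changing \<open>cur\<close> at a non-operand leaves all operand values intact, so the
  locality clause of \<open>is_system_2d\<close> keeps the update unchanged.\<close>

lemma depends_on_imp_operand:
  assumes "is_system_2d S" "q \<in> quantities S" "depends_on S t q p"
  shows "p \<in> operands S t q"
proof (rule ccontr)
  assume "p \<notin> operands S t q"
  then have "update S t q x prev (cur(p := a)) = update S t q x prev cur" for x prev cur a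
    using assms(1,2) unfolding is_system_2d_def by (metis fun_upd_other)
  with assms(3) show False
    by (simp add: depends_on_def)
qed

lemma ordered_recurrence_vpath:
  assumes "is_system_2d S" "ordered_recurrence S \<sigma>"
  shows "vpath (map (\<lambda>c. vertical_state S (\<sigma> c)) [1..<nvars S + 1])
    (with_proj (comp_graph S t))" (is "vpath (map ?h _) ?G")
proof -
  have \<sigma>: "\<sigma> permutes {1..nvars S}"
    and dep: "\<And>c. c \<in> {1..<nvars S} \<Longrightarrow> depends_on S t (?h (c + 1)) (?h c)"
    using assms(2) by (auto simp: ordered_recurrence_def)
  have vert: "?h c \<in> quantities S" if "c \<in> {1..nvars S}" for c
    using permutes_in_image[OF \<sigma>] that by simp
  have step: "(?h c, ?h (c + 1)) \<in> arcs_ends ?G" if "c \<in> {1..<nvars S}" for c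
    using depends_on_imp_operand[OF assms(1) vert dep[OF that]] vert[of "c + 1"] that
    by (simp add: parcs_comp_graph)
  have "vwalk (map ?h [1..<nvars S + 1]) ?G"
    \<comment> \<open>Here \<open>is_system_2d\<close> supplies \<open>nvars S \<ge> 1\<close>, so
      that the index range is nonempty.\<close>
    using assms(1) vert step by (intro vwalk_map_upt) (auto simp: is_system_2d_def)
  moreover have "distinct (map ?h [1..<nvars S + 1])"
    by (auto simp: distinct_map inj_eq[OF permutes_inj[OF \<sigma>]] intro!: inj_onI)
  ultimately show ?thesis
    by (simp add: vpath_def)
qed

lemma length_le_dependency_depth:
  fixes S :: "('k::finite, 'x, 'a) system_2d"
  assumes "vpath p (with_proj (comp_graph S t))"
  shows "length p \<le> dependency_depth S t"
  unfolding dependency_depth_def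
  using assms by (intro Max_ge vpath_finite_lengths) (auto simp: finite_quantities)

lemma dependency_depth_le:
  fixes S :: "('k::finite, 'x, 'a) system_2d"
  assumes "\<And>p. vpath p (with_proj (comp_graph S t)) \<Longrightarrow> length p \<le> K"
  shows "dependency_depth S t \<le> K"
proof -
  \<comment> \<open>\<open>Max_le_iff\<close> needs a nonempty set of lengths;
    \<open>Descriptor\<close> is always a vertex and gives a path of length 1.\<close>
  have "vpath [Descriptor] (with_proj (comp_graph S t))"
    by (simp add: vpath_def vwalk_def quantities_def)
  then show ?thesis
    unfolding dependency_depth_def
    using assms by (subst Max_le_iff) (auto intro!: vpath_finite_lengths simp: finite_quantities)
qed

text \<open>Going backwards along the walk, each new vertex is an operand of a vertex in column
  \<open>c\<close>, hence in that column or equal to \<open>Descriptor\<close>, which is excluded.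
  Vertices and arcs are assumed separately so that the lemma applies directly to segments of a
  path.\<close>

lemma descriptor_mediated_walk_column:
  assumes "descriptor_mediated S"
    and "set p \<subseteq> quantities S" "set (vwalk_arcs p) \<subseteq> arcs_ends (with_proj (comp_graph S t))"
    and "p \<noteq> []" "Descriptor \<notin> set p"
  shows "\<exists>c\<in>{1..nvars S}. set p \<subseteq> range (\<lambda>k. Local k c)"
  using assms(2-)
proof (induction p rule: vwalk_arcs.induct)
  case (2 q)
  then show ?case
    by (cases q) (auto intro!: bexI)
next
  case (3 q r p)
  then obtain c where c: "c \<in> {1..nvars S}" "set (r # p) \<subseteq> range (\<lambda>k. Local k c)"
    by auto
  then obtain k where "r = Local k c"
    by auto
  moreover have "q \<in> operands S t r"
    using "3.prems" by (simp add: parcs_comp_graph)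
  moreover have "operands S t (Local k c) \<subseteq> insert Descriptor (range (\<lambda>j. Local j c))"
    using assms(1) c(1) by (simp add: descriptor_mediated_def)
  moreover have "q \<noteq> Descriptor"
    using "3.prems" by auto
  ultimately have "q \<in> range (\<lambda>k. Local k c)"
    by blast
  with c show ?case
    by auto
qed simp

lemma column_length_le:
  assumes "distinct p" "set p \<subseteq> range (\<lambda>k::'k::finite. Local k c)"
  shows "length p \<le> CARD('k)"
  using card_mono[OF _ assms(2)] card_image_le[of "UNIV :: 'k set" "\<lambda>k. Local k c"]
    distinct_card[OF assms(1)] by simp

text \<open>A path visits \<^const>\<open>Descriptor\<close> at most once, and before and after that visit it stays with
  a single variable, hence the bound below.\<close>

lemma descriptor_mediated_path_length:
  fixes S :: "('k::finite, 'x, 'a) system_2d"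
  assumes S: "descriptor_mediated S" and p: "vpath p (with_proj (comp_graph S t))"
  shows "length p \<le> 2 * CARD('k) + 1"
proof -
  have column: "length q \<le> CARD('k)"
    if "set q \<subseteq> quantities S" "set (vwalk_arcs q) \<subseteq> arcs_ends (with_proj (comp_graph S t))"
      "distinct q" "Descriptor \<notin> set q" for q
    using descriptor_mediated_walk_column[OF S that(1,2) _ that(4)] column_length_le[OF that(3)]
    \<comment> \<open>Segments may be empty, as \<open>Descriptor\<close> can be the first or last
      vertex of the path.\<close>
    by (cases "q = []") auto
  have p': "set p \<subseteq> quantities S" "set (vwalk_arcs p) \<subseteq> arcs_ends (with_proj (comp_graph S t))"
    "distinct p"
    using p by (auto simp: vpath_def vwalk_def)
  show ?thesis
  proof (cases "Descriptor \<in> set p")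
    case False
    with column[OF p'] show ?thesis
      by simp
  next
    case True
    then obtain q r where pqr: "p = q @ Descriptor # r"
      by (meson split_list)
    \<comment> \<open>Both segments inherit their arcs from \<open>p\<close>; distinctness of
      \<open>p\<close> keeps \<open>Descriptor\<close> out of each.\<close>
    have "set (vwalk_arcs q) \<subseteq> set (vwalk_arcs p)" "set (vwalk_arcs r) \<subseteq> set (vwalk_arcs p)"
      using in_set_vwalk_arcs_append1[of _ q "Descriptor # r"]
        in_set_vwalk_arcs_append1[of _ "q @ [Descriptor]" r]
      by (auto simp: pqr)
    then have "length q \<le> CARD('k)" "length r \<le> CARD('k)"
      using p' by (auto intro!: column simp: pqr)
    then show ?thesis
      by (simp add: pqr)
  qed
qed

theorem theorem2:
  shows "(\<forall>(S :: ('k::finite, 'x, 'a) system_2d) \<sigma> t.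
            is_system_2d S \<and> ordered_recurrence S \<sigma> \<longrightarrow>
            vpath (map (\<lambda>c. vertical_state S (\<sigma> c)) [1..<nvars S + 1])
              (with_proj (comp_graph S t)) \<and>
            dependency_depth S t \<ge> nvars S) \<and>
         (\<exists>K. \<forall>(S :: ('k, 'x, 'a) system_2d) t.
            is_system_2d S \<and> descriptor_mediated S \<longrightarrow>
            dependency_depth S t \<le> K \<and>
            (\<forall>p. vpath p (with_proj (comp_graph S t)) \<and> Descriptor \<notin> set p \<longrightarrow>
              (\<exists>c\<in>{1..nvars S}. set p \<subseteq> range (\<lambda>k. Local k c))))"
\<comment> \<open>The witness counts one column before \<open>Descriptor\<close>, one after it, and
  \<open>Descriptor\<close> itself.\<close>
proof (intro conjI allI impI exI[of _ "2 * CARD('k) + 1"])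
  fix S :: "('k, 'x, 'a) system_2d" and \<sigma> t
  assume "is_system_2d S \<and> ordered_recurrence S \<sigma>"
  then show path: "vpath (map (\<lambda>c. vertical_state S (\<sigma> c)) [1..<nvars S + 1])
      (with_proj (comp_graph S t))"
    using ordered_recurrence_vpath by blast
  show "dependency_depth S t \<ge> nvars S"
    using length_le_dependency_depth[OF path] by (simp del: upt_Suc)
next
  fix S :: "('k, 'x, 'a) system_2d" and t
  assume S: "is_system_2d S \<and> descriptor_mediated S"
  then show "dependency_depth S t \<le> 2 * CARD('k) + 1"
    by (blast intro: dependency_depth_le descriptor_mediated_path_length)
  fix p
  assume "vpath p (with_proj (comp_graph S t)) \<and> Descriptor \<notin> set p"
  with S show "\<exists>c\<in>{1..nvars S}. set p \<subseteq> range (\<lambda>k. Local k c)"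
    by (intro descriptor_mediated_walk_column) (auto simp: vpath_def vwalk_def)
qed

end
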